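(* Let $f \in \mathcal{S}_{\rho}^{*}$. Then $$|\sigma_3(f)(0)| \le 3 \quad\text{and}\quad |\sigma_4(f)(0)| \le \frac{44}{3}.$$ These bounds are sharp, i.e. for each of the two inequalities there is a function in $\mathcal{S}_\rho^*$ for which equality holds.
   Context: $\mathbb{D}=\{z\in\mathbb{C}:|z|<1\}$. $\mathcal{A}$ is the class of analytic functions $f$ on $\mathbb{D}$ with $f(0)=0$, $f'(0)=1$. For analytic $f,g$ on $\mathbb{D}$, $f\prec g$ (subordination) means there is an analytic function $\omega$ on $\mathbb{D}$ with $\omega(0)=0$, $|\omega(z)|<1$ and $f(z)=g(\omega(z))$ for all $z\in\mathbb{D}$. $\mathcal{S}^*_\rho$ is the class of $f\in\mathcal{A}$ such that $\frac{zf'(z)}{f(z)}\prec 1+\sinh^{-1}(z)$, where $\sinh^{-1}$ is the branch of the inverse hyperbolic sine analytic on $\mathbb{D}$ with $\sinh^{-1}(0)=0$, i.e. $\sinh^{-1}(x)=x-\frac16x^3+\cdots$. Higher-order (Schippers) Schwarzian derivatives of a locally univalent function $f$ on $\mathbb{D}$: $\sigma_3(f)=S_f=\left(\frac{f''}{f'}\right)'-\frac12\left(\frac{f''}{f'}\right)^2$ and, for $n\ge 3$, $\sigma_{n+1}(f)=\sigma_n'(f)-(n-1)\sigma_n(f)\frac{f''}{f'}$, where $\sigma_n'(f)$ is the derivative of the function $\sigma_n(f)$ with respect to $z$. For $f(z)=z+\sum_{n\ge2}a_nz^n$ the values at the origin are $\sigma_3(f)(0)=6(a_3-a_2^2)$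 and $\sigma_4(f)(0)=24(a_4-3a_2a_3+2a_2^3)$. *)

theory Defs
  imports "HOL-Complex_Analysis.Complex_Analysis"
begin

definition class_A :: "(complex \<Rightarrow> complex) set" where
  "class_A = {f. f holomorphic_on ball 0 1 \<and> f 0 = 0 \<and> deriv f 0 = 1}"

definition subordinate :: "(complex \<Rightarrow> complex) \<Rightarrow> (complex \<Rightarrow> complex) \<Rightarrow> bool"
    (infix \<open>\<prec>\<^sub>D\<close> 50) where
  "f \<prec>\<^sub>D g \<longleftrightarrow>
     f holomorphic_on ball 0 1 \<and> g holomorphic_on ball 0 1 \<and>
     (\<exists>\<omega>. \<omega> holomorphic_on ball 0 1 \<and> \<omega> 0 = 0 \<and>
          (\<forall>z\<in>ball 0 1. cmod (\<omega> z) < 1 \<and> f z = g (\<omega> z)))"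

text \<open>
  The function \<open>z f'(z) / f(z)\<close>, with the removable singularity at the origin filled in
  (for \<open>f\<close> in \<open>class_A\<close> the limit there is 1, whereas HOL division would give 0).
  At any other zero of \<open>f\<close> the quotient has a pole, where HOL division also gives 0;
  such \<open>f\<close> are excluded from \<open>S_rho\<close> below because subordination requires this
  function to be holomorphic on the whole disc.
\<close>
definition starlike_quotient :: "(complex \<Rightarrow> complex) \<Rightarrow> complex \<Rightarrow> complex" where
  "starlike_quotient f z = (if z = 0 then 1 else z * deriv f z / f z)"

text \<open>
  On the unit disc the library function \<open>arsinh\<close>, defined by principal branches as
  \<open>ln (z + (z\<^sup>2 + 1) powr (1/2))\<close>, is the required analytic branch: see
  \<open>arsinh_holomorphic\<close>, \<open>sinh_arsinh\<close> and \<open>arsinh_0_complex\<close>, which determine it uniquely.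
\<close>
definition S_rho :: "(complex \<Rightarrow> complex) set" where
  "S_rho = {f \<in> class_A. starlike_quotient f \<prec>\<^sub>D (\<lambda>z. 1 + arsinh z)}"

lemma arsinh_complex_eq: "arsinh z = Ln (z + csqrt (z\<^sup>2 + 1))" if "z \<in> ball 0 1" for z :: complex
proof -
  have "z\<^sup>2 + 1 \<noteq> 0"
  proof
    assume "z\<^sup>2 + 1 = 0"
    then have "cmod (z\<^sup>2) = 1" by (metis add_eq_0_iff2 norm_minus_cancel norm_one)
    with that show False
      using power_less_one_iff[of "cmod z" 2] by (simp add: norm_power)
  qed
  then show ?thesis
    by (simp add: arsinh_def csqrt_conv_powr)
qed

lemma arsinh_holomorphic: "arsinh holomorphic_on ball (0::complex) 1"
proof -
  have 1: "z\<^sup>2 + 1 \<notin> \<real>\<^sub>\<le>\<^sub>0" if "z \<in> ball 0 1" for z :: complex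
  proof -
    have "\<bar>Re (z\<^sup>2)\<bar> \<le> cmod (z\<^sup>2)" by (rule abs_Re_le_cmod)
    also have "\<dots> < 1" using that by (simp add: norm_power power_less_one_iff)
    finally show ?thesis by (auto simp: complex_nonpos_Reals_iff)
  qed
  have 2: "z + csqrt (z\<^sup>2 + 1) \<notin> \<real>\<^sub>\<le>\<^sub>0" if z: "z \<in> ball 0 1" for z :: complex
  proof
    assume "z + csqrt (z\<^sup>2 + 1) \<in> \<real>\<^sub>\<le>\<^sub>0"
    then obtain t where t: "t \<ge> 0" "z + csqrt (z\<^sup>2 + 1) = - of_real t"
      by (metis minus_minus neg_0_le_iff_le nonpos_Reals_cases of_real_minus)
    then have "csqrt (z\<^sup>2 + 1) = - (z + of_real t)" by (simp add: algebra_simps eq_neg_iff_add_eq_0)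
    then have "z\<^sup>2 + 1 = (z + of_real t)\<^sup>2" by (metis power2_csqrt power2_minus)
    then have eq: "1 = of_real t * (2 * z + of_real t)" by (simp add: power2_eq_square algebra_simps)
    then have "t \<noteq> 0" by auto
    with eq have "Im z = 0" by (auto simp: complex_eq_iff)
    then have zr: "z = of_real (Re z)" by (simp add: complex_eq_iff)
    define x where "x = Re z"
    have "csqrt (z\<^sup>2 + 1) = csqrt (of_real (x\<^sup>2 + 1))" using zr by (simp add: x_def)
    also have "\<dots> = of_real (sqrt (x\<^sup>2 + 1))" by (rule of_real_sqrt [symmetric]) simp
    finally have "of_real (x + sqrt (x\<^sup>2 + 1)) = (of_real (- t) :: complex)"
      using t zr by (simp add: x_def)
    then have "x + sqrt (x\<^sup>2 + 1) = - t" by (simp only: of_real_eq_iff)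
    moreover have "sqrt (x\<^sup>2 + 1) > \<bar>x\<bar>" by (rule real_less_rsqrt) simp
    ultimately show False using t(1) by linarith
  qed
  have "(\<lambda>z. Ln (z + csqrt (z\<^sup>2 + 1))) holomorphic_on ball 0 1"
    by (intro holomorphic_intros) (use 1 2 in auto)
  then show ?thesis
    by (rule holomorphic_transform) (simp add: arsinh_complex_eq)
qed

lemma sinh_arsinh: "sinh (arsinh z) = z" if "z \<in> ball 0 1" for z :: complex
proof -
  define w where "w = z + csqrt (z\<^sup>2 + 1)"
  have *: "w * (csqrt (z\<^sup>2 + 1) - z) = 1"
    using power2_csqrt[of "z\<^sup>2 + 1"] by (simp add: w_def power2_eq_square algebra_simps)
  then have "w \<noteq> 0" by auto
  moreover have "inverse w = csqrt (z\<^sup>2 + 1) - z"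
    using * by (simp add: inverse_unique)
  ultimately show ?thesis
    using that by (simp add: arsinh_complex_eq sinh_def exp_minus scaleR_conv_of_real flip: w_def)
      (simp add: w_def)
qed

lemma arsinh_0_complex: "arsinh (0::complex) = 0"
  by (simp add: arsinh_complex_eq)

definition Schwarzian :: "(complex \<Rightarrow> complex) \<Rightarrow> complex \<Rightarrow> complex" where
  "Schwarzian f z = deriv (\<lambda>w. deriv (deriv f) w / deriv f w) z
                    - 1 / 2 * (deriv (deriv f) z / deriv f z)\<^sup>2"

text \<open>Schippers' higher-order Schwarzians are indexed from 3; the values at indices 0, 1, 2 are dummies.\<close>
primrec higher_Schwarzian :: "nat \<Rightarrow> (complex \<Rightarrow> complex) \<Rightarrow> complex \<Rightarrow> complex" (\<open>\<sigma>\<close>) where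
  "\<sigma> 0 f = (\<lambda>z. 0)"
| "\<sigma> (Suc n) f =
     (if n < 2 then (\<lambda>z. 0)
      else if n = 2 then Schwarzian f
      else (\<lambda>z. deriv (\<sigma> n f) z - (of_nat n - 1) * \<sigma> n f z * (deriv (deriv f) z / deriv f z)))"

end

(* Write z f'/f = 1 + arsinh w for a Schwarz function w = b1 z + b2 z^2 + b3 z^3 + ...
   Comparing coefficients, sigma_3(0) = 3 (b2 - b1^2) and
   sigma_4(0) = 8 (b3 - 3 b1 b2 + (11/6) b1^3), so w = z attains 3 and 44/3.
   Two steps of Schur's algorithm after dividing w by z give, with |zeta|, |eta| <= 1,
     b2 = zeta (1 - |b1|^2),
     b3 = (1 - |b1|^2) (eta (1 - |zeta|^2) - zeta^2 cnj b1).
   For sigma_4 the triangle inequality on the single terms is too weak. It may be used to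
   split off eta, but the phases of zeta and b1 have to be kept in the remaining part; after
   rotating b1 to the positive axis, its modulus is controlled by a polynomial inequality
   in |b1|^2, |zeta|^2 and Re zeta. *)
theory Submission
  imports Defs
begin

section \<open>Schur's algorithm and the coefficients of Schwarz functions\<close>

text \<open>If |\<open>\<phi>\<close>| reaches 1, the maximum principle makes \<open>\<phi>\<close>
  constant and \<open>q\<close> = 0 works. Otherwise the Schwarz lemma applies to the Moebius
  transform of \<open>\<phi>\<close> that sends \<open>\<phi> 0\<close> to 0, and \<open>q\<close>
  is its quotient by z. Clearing the denominator lets one identity serve both cases, including
  unimodular constants.\<close>

lemma Schur_step:
  fixes \<phi> :: "complex \<Rightarrow> complex"
  assumes hol: "\<phi> holomorphic_on ball 0 1" and bound: "\<And>z. cmod z < 1 \<Longrightarrow> cmod (\<phi> z) \<le> 1"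
  obtains q where "q holomorphic_on ball 0 1" "\<And>z. cmod z < 1 \<Longrightarrow> cmod (q z) \<le> 1"
    "\<And>z. cmod z < 1 \<Longrightarrow> \<phi> z - \<phi> 0 = z * q z * (1 - cnj (\<phi> 0) * \<phi> z)"
proof (cases "\<exists>w. cmod w < 1 \<and> cmod (\<phi> w) = 1")
  case True
  then obtain w where w: "cmod w < 1" "cmod (\<phi> w) = 1" by blast
  have "\<phi> constant_on ball 0 1"
    by (rule maximum_modulus_principle[where U = "ball 0 1" and \<xi> = w])
      (use hol bound w in auto)
  then obtain c where c: "\<And>z. cmod z < 1 \<Longrightarrow> \<phi> z = c"
    by (auto simp: constant_on_def)
  show thesis
    by (rule that[of "\<lambda>_. 0"]) (simp_all add: c)
next
  case False
  then have lt: "cmod (\<phi> z) < 1" if "cmod z < 1" for z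
    using bound[of z] that by force
  define \<psi> where "\<psi> = Moebius_function 0 (\<phi> 0) \<circ> \<phi>"
  have b: "cmod (\<phi> 0) < 1" using lt by simp
  have hol\<psi>: "\<psi> holomorphic_on ball 0 1"
    unfolding \<psi>_def
    by (rule holomorphic_on_compose_gen[OF hol Moebius_function_holomorphic[OF b]]) (use lt in auto)
  have \<psi>0: "\<psi> 0 = 0" by (simp add: \<psi>_def Moebius_function_eq_zero)
  have \<psi>lt: "cmod (\<psi> z) < 1" if "cmod z < 1" for z
    using that by (simp add: \<psi>_def Moebius_function_norm_lt_1 b lt)
  obtain q where q: "q holomorphic_on ball 0 1" "\<And>z. cmod z < 1 \<Longrightarrow> \<psi> z = z * q z" "deriv \<psi> 0 = q 0"
    using Schwarz3[OF hol\<psi> \<psi>0] by blast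
  show thesis
  proof (rule that[OF q(1)])
    fix z :: complex
    assume z: "cmod z < 1"
    show "cmod (q z) \<le> 1"
    proof (cases "z = 0")
      case True
      then show ?thesis
        using Schwarz_Lemma(2)[OF hol\<psi> \<psi>0 \<psi>lt z] q(3) by simp
    next
      case False
      then show ?thesis
        using Schwarz_Lemma(1)[OF hol\<psi> \<psi>0 \<psi>lt z] q(2)[OF z] by (simp add: norm_mult)
    qed
    have "cmod (\<phi> 0) * cmod (\<phi> z) \<le> cmod (\<phi> 0)"
      using lt[OF z] by (intro mult_left_le) auto
    then have "cmod (cnj (\<phi> 0) * \<phi> z) < 1"
      using b by (simp add: norm_mult)
    then have "1 - cnj (\<phi> 0) * \<phi> z \<noteq> 0" by force
    moreover have "\<psi> z = (\<phi> z - \<phi> 0) / (1 - cnj (\<phi> 0) * \<phi> z)"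
      by (simp add: \<psi>_def Moebius_function_simple)
    ultimately show "\<phi> z - \<phi> 0 = z * q z * (1 - cnj (\<phi> 0) * \<phi> z)"
      using q(2)[OF z] by (simp add: field_simps)
  qed
qed

lemma fps_nth_mult_2: "fps_nth (F * G) 2 =
    fps_nth F 0 * fps_nth G 2 + fps_nth F 1 * fps_nth G 1 + fps_nth F 2 * fps_nth G 0"
  by (simp add: fps_mult_nth numeral_2_eq_2 add.assoc)

lemma fps_nth_mult_3: "fps_nth (F * G) 3 = fps_nth F 0 * fps_nth G 3 +
    fps_nth F 1 * fps_nth G 2 + fps_nth F 2 * fps_nth G 1 + fps_nth F 3 * fps_nth G 0"
  by (simp add: fps_mult_nth numeral_3_eq_3 numeral_2_eq_2 add.assoc)

text \<open>Passes from a functional equation on the disc to an identity of formal power series,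
  whose coefficients can then be compared.\<close>

lemma has_fps_expansion_unit_disc_eqD:
  fixes f g :: "complex \<Rightarrow> complex"
  assumes "f has_fps_expansion F" "g has_fps_expansion G" "\<And>z. cmod z < 1 \<Longrightarrow> f z = g z"
  shows "F = G"
proof -
  have "eventually (\<lambda>z. z \<in> ball 0 1) (nhds (0::complex))"
    by (rule eventually_nhds_in_open) auto
  then have "eventually (\<lambda>z. f z = g z) (nhds 0)"
    by eventually_elim (use assms(3) in auto)
  then have "g has_fps_expansion F"
    using assms(1) has_fps_expansion_cong by blast
  then show ?thesis
    using assms(2) fps_expansion_unique_complex by blast
qed

text \<open>The relations are the coefficients of z and z^2 in the identity of
  \<open>Schur_step\<close>. Holomorphy and the bound of \<open>q\<close> are passed on so that the
  step can be iterated.\<close>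

lemma Schur_step_fps:
  fixes \<phi> :: "complex \<Rightarrow> complex"
  assumes hol: "\<phi> holomorphic_on ball 0 1" and bound: "\<And>z. cmod z < 1 \<Longrightarrow> cmod (\<phi> z) \<le> 1"
    and \<Phi>: "\<phi> has_fps_expansion \<Phi>"
  obtains q X where "q holomorphic_on ball 0 1" "\<And>z. cmod z < 1 \<Longrightarrow> cmod (q z) \<le> 1"
    "q has_fps_expansion X" "cmod (fps_nth \<Phi> 0) \<le> 1"
    "fps_nth \<Phi> 1 = fps_nth X 0 * (1 - (cmod (fps_nth \<Phi> 0))\<^sup>2)"
    "fps_nth \<Phi> 2 = fps_nth X 1 * (1 - (cmod (fps_nth \<Phi> 0))\<^sup>2)
      - fps_nth X 0 * cnj (fps_nth \<Phi> 0) * fps_nth \<Phi> 1"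
proof -
  obtain q where q: "q holomorphic_on ball 0 1" "\<And>z. cmod z < 1 \<Longrightarrow> cmod (q z) \<le> 1"
    "\<And>z. cmod z < 1 \<Longrightarrow> \<phi> z - \<phi> 0 = z * q z * (1 - cnj (\<phi> 0) * \<phi> z)"
    using Schur_step[OF hol bound] by blast
  define X where "X = fps_expansion q 0"
  have X: "q has_fps_expansion X"
    unfolding X_def by (rule has_fps_expansion_fps_expansion[OF _ _ q(1)]) auto
  have \<phi>0: "\<phi> 0 = fps_nth \<Phi> 0"
    by (rule has_fps_expansion_imp_0_eq_fps_nth_0[OF \<Phi>])
  have "\<Phi> - fps_const (\<phi> 0) = fps_X * X * (1 - fps_const (cnj (\<phi> 0)) * \<Phi>)"
  proof (rule has_fps_expansion_unit_disc_eqD)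
    show "(\<lambda>z. \<phi> z - \<phi> 0) has_fps_expansion \<Phi> - fps_const (\<phi> 0)"
      by (intro fps_expansion_intros \<Phi>)
    show "(\<lambda>z. z * q z * (1 - cnj (\<phi> 0) * \<phi> z)) has_fps_expansion
        fps_X * X * (1 - fps_const (cnj (\<phi> 0)) * \<Phi>)"
      by (intro fps_expansion_intros \<Phi> X)
  qed (rule q(3))
  then have eq: "\<Phi> - fps_const (\<phi> 0) = fps_X * (X * (1 - fps_const (cnj (\<phi> 0)) * \<Phi>))"
    by (simp add: mult.assoc)
  have norm: "cnj (fps_nth \<Phi> 0) * fps_nth \<Phi> 0 = (cmod (fps_nth \<Phi> 0))\<^sup>2"
    by (simp only: complex_norm_square mult.commute)
  have c1: "fps_nth \<Phi> 1 = fps_nth X 0 * (1 - cnj (fps_nth \<Phi> 0) * fps_nth \<Phi> 0)"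
    using arg_cong[OF eq, of "\<lambda>F. fps_nth F 1"] by (simp add: \<phi>0)
  have c2: "fps_nth \<Phi> 2 = fps_nth X 1 * (1 - cnj (fps_nth \<Phi> 0) * fps_nth \<Phi> 0)
      - fps_nth X 0 * cnj (fps_nth \<Phi> 0) * fps_nth \<Phi> 1"
    using arg_cong[OF eq, of "\<lambda>F. fps_nth F 2"] by (simp add: \<phi>0 numeral_2_eq_2)
  show thesis
  proof (rule that[OF q(1,2) X])
    show "cmod (fps_nth \<Phi> 0) \<le> 1" using bound[of 0] by (simp add: \<phi>0)
  qed (use c1 c2 in \<open>simp_all add: norm\<close>)
qed

text \<open>Since \<open>\<omega>\<close> vanishes at 0, the first Schur step is just division by z.
  Two further steps give \<open>\<zeta>\<close> and \<open>\<eta>\<close> as the values at 0 of the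
  successive quotients.\<close>

lemma Schwarz_function_coefficients:
  fixes \<omega> :: "complex \<Rightarrow> complex"
  assumes hol: "\<omega> holomorphic_on ball 0 1" and "\<omega> 0 = 0"
    and bound: "\<And>z. cmod z < 1 \<Longrightarrow> cmod (\<omega> z) < 1" and W: "\<omega> has_fps_expansion W"
  obtains \<zeta> \<eta> :: complex where "cmod (fps_nth W 1) \<le> 1" "cmod \<zeta> \<le> 1" "cmod \<eta> \<le> 1"
    "fps_nth W 2 = \<zeta> * (1 - (cmod (fps_nth W 1))\<^sup>2)"
    "fps_nth W 3 = (1 - (cmod (fps_nth W 1))\<^sup>2) *
      (\<eta> * (1 - (cmod \<zeta>)\<^sup>2) - \<zeta>\<^sup>2 * cnj (fps_nth W 1))"
proof -
  have le: "cmod (\<omega> z) \<le> 1" if "cmod z < 1" for z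
    using bound[OF that] by simp
  obtain \<phi> where \<phi>: "\<phi> holomorphic_on ball 0 1" "\<And>z. cmod z < 1 \<Longrightarrow> cmod (\<phi> z) \<le> 1"
    "\<And>z. cmod z < 1 \<Longrightarrow> \<omega> z = z * \<phi> z"
    using Schur_step[OF hol le] \<open>\<omega> 0 = 0\<close> by auto
  define \<Phi> where "\<Phi> = fps_expansion \<phi> 0"
  have \<Phi>: "\<phi> has_fps_expansion \<Phi>"
    unfolding \<Phi>_def by (rule has_fps_expansion_fps_expansion[OF _ _ \<phi>(1)]) auto
  have "(\<lambda>z. z * \<phi> z) has_fps_expansion fps_X * \<Phi>"
    by (intro fps_expansion_intros \<Phi>)
  then have "W = fps_X * \<Phi>"
    using has_fps_expansion_unit_disc_eqD[OF W] \<phi>(3) by blast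
  then have W\<Phi>: "fps_nth W 1 = fps_nth \<Phi> 0" "fps_nth W 2 = fps_nth \<Phi> 1" "fps_nth W 3 = fps_nth \<Phi> 2"
    by (simp_all add: numeral_3_eq_3 numeral_2_eq_2)
  obtain q X where q: "q holomorphic_on ball 0 1" "\<And>z. cmod z < 1 \<Longrightarrow> cmod (q z) \<le> 1"
    "q has_fps_expansion X" "cmod (fps_nth \<Phi> 0) \<le> 1"
    and c1: "fps_nth \<Phi> 1 = fps_nth X 0 * (1 - (cmod (fps_nth \<Phi> 0))\<^sup>2)"
    and c2: "fps_nth \<Phi> 2 = fps_nth X 1 * (1 - (cmod (fps_nth \<Phi> 0))\<^sup>2)
      - fps_nth X 0 * cnj (fps_nth \<Phi> 0) * fps_nth \<Phi> 1"
    using Schur_step_fps[OF \<phi>(1,2) \<Phi>] by metis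
  obtain \<psi> Y where \<psi>: "\<And>z. cmod z < 1 \<Longrightarrow> cmod (\<psi> z) \<le> 1"
    "\<psi> has_fps_expansion Y" "cmod (fps_nth X 0) \<le> 1"
    and d1: "fps_nth X 1 = fps_nth Y 0 * (1 - (cmod (fps_nth X 0))\<^sup>2)"
    using Schur_step_fps[OF q(1-3)] by metis
  have "cmod (fps_nth Y 0) \<le> 1"
    using \<psi>(1)[of 0] has_fps_expansion_imp_0_eq_fps_nth_0[OF \<psi>(2)] by simp
  then show thesis
  proof (rule that[rotated 2])
    show "fps_nth W 3 = (1 - (cmod (fps_nth W 1))\<^sup>2) *
      (fps_nth Y 0 * (1 - (cmod (fps_nth X 0))\<^sup>2) - (fps_nth X 0)\<^sup>2 * cnj (fps_nth W 1))"
      unfolding W\<Phi> c2 c1 d1 by (simp add: algebra_simps power2_eq_square)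
  qed (use q \<psi> W\<Phi> c1 in simp_all)
qed

section \<open>The inequality for the Schur parameters\<close>

text \<open>The squared form of \<open>Schur_parameter_bound\<close>: \<open>t\<close> stands for
  |b|^2, \<open>r\<close> for |\<zeta>|^2, and \<open>u\<close> for the real part of \<zeta> after
  the rotation that makes b nonnegative; 1 - \<open>t\<close> is the factor \<open>s\<close>
  there.\<close>

lemma Schur_parameter_bound_real:
  fixes r t u :: real
  assumes r: "0 \<le> r" "r \<le> 1" and t: "0 \<le> t" "t \<le> 1"
  shows "t * ((1 - t)\<^sup>2 * r * (r + 9 + 6 * u) - 11 / 3 * (1 - t) * t * (2 * u\<^sup>2 - r + 3 * u) + 121 / 36 * t\<^sup>2)
    \<le> (11 / 6 - (1 - t) * (1 - r))\<^sup>2" (is "?L \<le> ?R")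
proof -
  define Q0 where "Q0 = 121 / 36 * (1 + t + t\<^sup>2) - 8 / 3 - t - 33 / 8 * t\<^sup>2"
  define Q1 where "Q1 = 121 / 36 * (1 + t + t\<^sup>2) - 10 * t * (1 - t) - 11 / 3 * t\<^sup>2 - 27 / 22 * (1 - 17 / 6 * t)\<^sup>2"
  \<comment> \<open>Completing the square in \<open>u\<close> leaves a concave function of \<open>r\<close>, so that only the
    end points \<open>r = 0\<close> and \<open>r = 1\<close> matter; there \<open>?R - ?L\<close> is \<open>1 - t\<close> times \<open>Q0\<close> or \<open>Q1\<close>,
    up to the square.\<close>
  have "?R - ?L = (1 - r) * ((1 - t) * Q0) + r * ((1 - t) * Q1) + 5 / 22 * (1 - t) ^ 3 * (r * (1 - r))
     + 6 / 11 * (1 - t) * (3 / 2 * ((1 - t) * r - 11 / 6 * t) - 11 / 3 * (t * u))\<^sup>2"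
    unfolding Q0_def Q1_def by (simp add: field_simps power2_eq_square power3_eq_cube)
  \<comment> \<open>Expanded, \<open>Q0\<close> = 25/36 + 85/36 t - 55/72 t^2 and \<open>Q1\<close>
    = 845/396 + 125/396 t - 125/792 t^2, so the linear term outweighs the only negative one.\<close>
  moreover have "t\<^sup>2 \<le> t" using t by (simp add: power2_eq_square mult_left_le)
  then have "Q0 \<ge> 0" "Q1 \<ge> 0"
    using t unfolding Q0_def Q1_def power2_eq_square by (auto simp: field_simps)
  ultimately have "?R - ?L \<ge> 0"
    using r t by simp
  then show ?thesis by simp
qed

text \<open>The right-hand side is the room left below 11/6 once the term with \<eta> has been split
  off at cost s (1 - |\<zeta>|^2). Equality holds when |b| = 1, as for the Schwarz function
  z.\<close>

lemma Schur_parameter_bound: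
  fixes b \<zeta> :: complex
  assumes b: "cmod b \<le> 1" and \<zeta>: "cmod \<zeta> \<le> 1"
  defines "s \<equiv> 1 - (cmod b)\<^sup>2"
  shows "cmod (11 / 6 * b ^ 3 - s * (\<zeta>\<^sup>2 * cnj b + 3 * b * \<zeta>)) \<le> 11 / 6 - s * (1 - (cmod \<zeta>)\<^sup>2)"
proof -
  \<comment> \<open>With \<open>b = x * e\<close> and \<open>\<zeta> = e\<^sup>2 * w\<close>, every term carries the common phase \<open>e ^ 3\<close>.\<close>
  obtain e :: complex where e: "cmod e = 1" "b = cmod b * e"
  proof (cases "b = 0")
    case True
    then show thesis using that[of 1] by simp
  next
    case False
    then show thesis using that[of "b / cmod b"] by (simp add: norm_divide)
  qed
  define x where "x = cmod b"
  define w where "w = cnj (e\<^sup>2) * \<zeta>"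
  define u where "u = Re w"
  define r where "r = (cmod w)\<^sup>2"
  have x: "0 \<le> x" "x \<le> 1" using b by (auto simp: x_def)
  then have x2: "x\<^sup>2 \<le> 1" by (simp add: power_le_one)
  have ee: "e * cnj e = 1" using e(1) by (simp add: complex_norm_square [symmetric])
  have "e\<^sup>2 * w = (e * cnj e)\<^sup>2 * \<zeta>"
    by (simp add: w_def power_mult_distrib)
  then have \<zeta>w: "\<zeta> = e\<^sup>2 * w"
    by (simp add: ee)
  have r: "0 \<le> r" "r \<le> 1" "r = (cmod \<zeta>)\<^sup>2"
    using e(1) \<zeta> by (auto simp: r_def \<zeta>w norm_mult norm_power power_le_one)
  have bx: "b = x * e" using e(2) by (simp add: x_def)
  have "\<zeta>\<^sup>2 * cnj b = (e * cnj e) * (e ^ 3 * (x * w\<^sup>2))"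
    unfolding \<zeta>w bx by (simp add: power2_eq_square power3_eq_cube)
  also have "\<dots> = e ^ 3 * (x * w\<^sup>2)"
    by (simp only: ee mult_1_left)
  finally have "\<zeta>\<^sup>2 * cnj b = e ^ 3 * (x * w\<^sup>2)" .
  then have *: "11 / 6 * b ^ 3 - s * (\<zeta>\<^sup>2 * cnj b + 3 * b * \<zeta>)
      = e ^ 3 * (x * (11 / 6 * x\<^sup>2 - s * (w\<^sup>2 + 3 * w)))"
    by (simp only:) (simp add: bx \<zeta>w algebra_simps power2_eq_square power3_eq_cube)
  \<comment> \<open>The modulus to be estimated depends on \<open>Im w\<close> only through its
    square, so \<open>r\<close> and \<open>u\<close> are all that remains of
    \<open>w\<close>.\<close>
  have wr: "(Im w)\<^sup>2 = r - u\<^sup>2"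
    by (simp add: r_def u_def cmod_power2)
  have sx: "s = 1 - x\<^sup>2" by (simp add: s_def x_def)
  have ReIm: "Re (11 / 6 * x\<^sup>2 - s * (w\<^sup>2 + 3 * w)) = 11 / 6 * x\<^sup>2 - s * (u\<^sup>2 - (Im w)\<^sup>2 + 3 * u)"
    "Im (11 / 6 * x\<^sup>2 - s * (w\<^sup>2 + 3 * w)) = - (s * Im w * (2 * u + 3))"
    unfolding of_real_power [symmetric] by (simp_all add: u_def Re_power2 Im_power2 algebra_simps)
  have "(cmod (11 / 6 * x\<^sup>2 - s * (w\<^sup>2 + 3 * w)))\<^sup>2
    = (11 / 6 * x\<^sup>2 - s * (u\<^sup>2 - (Im w)\<^sup>2 + 3 * u))\<^sup>2 + s\<^sup>2 * (Im w)\<^sup>2 * (2 * u + 3)\<^sup>2"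
    unfolding cmod_power2 ReIm by (simp add: power_mult_distrib)
  also have "\<dots> = s\<^sup>2 * r * (r + 9 + 6 * u) - 11 / 3 * s * x\<^sup>2 * (2 * u\<^sup>2 - r + 3 * u) + 121 / 36 * (x\<^sup>2)\<^sup>2"
    unfolding wr by (simp add: field_simps power2_eq_square)
  finally have sq: "(x * cmod (11 / 6 * x\<^sup>2 - s * (w\<^sup>2 + 3 * w)))\<^sup>2 \<le> (11 / 6 - s * (1 - r))\<^sup>2"
    using Schur_parameter_bound_real[OF r(1,2), of "x\<^sup>2" u] x2 by (simp add: sx power_mult_distrib)
  have "s * (1 - r) \<le> 1 * 1"
    by (rule mult_mono) (use x2 r in \<open>auto simp: sx\<close>)
  then have "0 \<le> 11 / 6 - s * (1 - r)" by simp
  with sq have "x * cmod (11 / 6 * x\<^sup>2 - s * (w\<^sup>2 + 3 * w)) \<le> 11 / 6 - s * (1 - r)"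
    by (rule power2_le_imp_le)
  moreover have "cmod (e ^ 3 * (x * (11 / 6 * x\<^sup>2 - s * (w\<^sup>2 + 3 * w))))
      = x * cmod (11 / 6 * x\<^sup>2 - s * (w\<^sup>2 + 3 * w))"
    unfolding norm_mult norm_power e(1) using x(1) by simp
  ultimately show ?thesis
    unfolding * r(3) [symmetric] by (simp only:)
qed

section \<open>Power series of \<open>arsinh\<close> and of the Schwarzians\<close>

text \<open>Differentiating sinh (arsinh z) = z and squaring gives (arsinh')^2 (1 + z^2) = 1, which
  avoids expanding the logarithm and the square root; the coefficients are read off from this
  equation.\<close>

lemma arsinh_fps_expansion:
  obtains A :: "complex fps" where "arsinh has_fps_expansion A"
    "fps_nth A 0 = 0" "fps_nth A 1 = 1" "fps_nth A 2 = 0" "fps_nth A 3 = - 1 / 6"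
proof -
  define A where "A = fps_expansion (arsinh :: complex \<Rightarrow> complex) 0"
  have A: "arsinh has_fps_expansion A"
    unfolding A_def by (rule has_fps_expansion_fps_expansion[OF _ _ arsinh_holomorphic]) auto
  have cosh_deriv: "cosh (arsinh z) * deriv arsinh z = 1" if z: "cmod z < 1" for z :: complex
  proof -
    have "(arsinh has_field_derivative deriv arsinh z) (at z)"
      using z by (intro holomorphic_derivI[OF arsinh_holomorphic]) auto
    then have "((\<lambda>w. sinh (arsinh w)) has_field_derivative cosh (arsinh z) * deriv arsinh z) (at z)"
      by (auto intro!: derivative_eq_intros)
    moreover have "((\<lambda>w. sinh (arsinh w)) has_field_derivative 1) (at z)"
      by (rule has_field_derivative_transform_within_open[of "\<lambda>w. w" _ _ "ball 0 1"])
        (use z in \<open>auto simp: sinh_arsinh\<close>)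
    ultimately show ?thesis by (rule DERIV_unique)
  qed
  have sq: "deriv arsinh z * deriv arsinh z * (1 + z * z) = 1" if z: "cmod z < 1" for z :: complex
  proof -
    have "(cosh (arsinh z))\<^sup>2 = 1 + z\<^sup>2"
      using z by (simp add: cosh_square_eq sinh_arsinh)
    then show ?thesis
      using arg_cong[OF cosh_deriv[OF z], of "\<lambda>x. x\<^sup>2"]
      by (simp add: power_mult_distrib power2_eq_square mult_ac)
  qed
  have "fps_deriv A * fps_deriv A * (1 + fps_X * fps_X) = 1"
  proof (rule has_fps_expansion_unit_disc_eqD)
    show "(\<lambda>z. deriv arsinh z * deriv arsinh z * (1 + z * z)) has_fps_expansion
        fps_deriv A * fps_deriv A * (1 + fps_X * fps_X)"
      by (intro fps_expansion_intros A)
  qed (use sq in auto)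
  then have eq: "fps_nth (fps_deriv A * fps_deriv A * (1 + fps_X * fps_X)) n = fps_nth 1 n" for n
    by simp
  have A0: "fps_nth A 0 = 0"
    using has_fps_expansion_imp_0_eq_fps_nth_0[OF A] by (simp add: arsinh_0_complex)
  \<comment> \<open>The squared equation leaves the sign of arsinh' open; the unsquared one fixes it
    at the origin.\<close>
  have "deriv arsinh 0 = (1::complex)"
    using cosh_deriv[of 0] by (simp add: arsinh_0_complex)
  then have A1: "fps_nth A 1 = 1"
    using has_fps_expansion_imp_0_eq_fps_nth_0[OF has_fps_expansion_deriv[OF A]] by simp
  have A2: "fps_nth A 2 = 0"
    using eq[of 1] A1 by (simp add: fps_mult_nth_1 numeral_2_eq_2)
  have "fps_nth A 3 = - 1 / 6"
    using eq[of 2, unfolded fps_nth_mult_2] A1 A2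
    by (simp add: numeral_3_eq_3 numeral_2_eq_2 field_simps add_eq_0_iff)
  then show thesis using that A A0 A1 A2 by blast
qed

text \<open>The series \<open>P\<close> of f''/f' is found recursively from P f' = f'', where f'(0)
  = 1 allows the division; the Schwarzians are polynomials in \<open>P\<close> and its
  derivatives.\<close>

lemma higher_Schwarzian_fps:
  assumes F: "f has_fps_expansion F" and F1: "fps_nth F 1 = 1"
  shows "\<sigma> 3 f 0 = 6 * (fps_nth F 3 - (fps_nth F 2)\<^sup>2)"
    and "\<sigma> 4 f 0 = 24 * (fps_nth F 4 - 3 * fps_nth F 2 * fps_nth F 3 + 2 * (fps_nth F 2) ^ 3)"
proof -
  define P where "P = fps_deriv (fps_deriv F) / fps_deriv F"
  define S where "S = fps_deriv P - fps_const (1 / 2) * P\<^sup>2"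
  \<comment> \<open>The factor 2 is n - 1 for n = 3, in the passage from index 3 to index 4.\<close>
  define T where "T = fps_deriv S - fps_const 2 * S * P"
  have D: "fps_nth (fps_deriv F) 0 \<noteq> 0" using F1 by simp
  have P: "(\<lambda>w. deriv (deriv f) w / deriv f w) has_fps_expansion P"
    unfolding P_def
    by (intro has_fps_expansion_divide' has_fps_expansion_deriv F D)
  have S: "Schwarzian f has_fps_expansion S"
    unfolding Schwarzian_def[abs_def] S_def by (intro fps_expansion_intros P)
  have \<sigma>3: "\<sigma> 3 f = Schwarzian f" by (simp add: numeral_3_eq_3)
  have \<sigma>4: "\<sigma> 4 f = (\<lambda>z. deriv (Schwarzian f) z - 2 * Schwarzian f z * (deriv (deriv f) z / deriv f z))"
    by (simp add: eval_nat_numeral)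
  have T: "\<sigma> 4 f has_fps_expansion T"
    unfolding \<sigma>4 T_def by (intro fps_expansion_intros P S)
  have "P * fps_deriv F = fps_deriv (fps_deriv F)"
    unfolding P_def using D by (simp add: fps_divide_unit mult.assoc inverse_mult_eq_1)
  then have eq: "fps_nth (P * fps_deriv F) n = fps_nth (fps_deriv (fps_deriv F)) n" for n
    by simp
  have P0: "fps_nth P 0 = 2 * fps_nth F 2"
    using eq[of 0] F1 by (simp add: numeral_2_eq_2)
  have P1: "fps_nth P 1 = 6 * fps_nth F 3 - 4 * (fps_nth F 2)\<^sup>2"
    using eq[of 1] F1 P0
    by (simp add: fps_mult_nth_1 eval_nat_numeral algebra_simps)
  have "fps_nth P 2 + fps_nth P 1 * (2 * fps_nth F 2) + fps_nth P 0 * (3 * fps_nth F 3) = 12 * fps_nth F 4"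
    using eq[of 2, unfolded fps_nth_mult_2] F1
    by (simp add: eval_nat_numeral algebra_simps)
  then have P2: "fps_nth P 2 = 12 * fps_nth F 4 - 18 * fps_nth F 2 * fps_nth F 3 + 8 * (fps_nth F 2) ^ 3"
    unfolding P0 P1 by (simp add: power2_eq_square power3_eq_cube) algebra
  have S0: "fps_nth S 0 = 6 * (fps_nth F 3 - (fps_nth F 2)\<^sup>2)"
    using P0 P1 by (simp add: S_def power2_eq_square)
  have S1': "fps_nth S 1 = 2 * fps_nth P 2 - fps_nth P 0 * fps_nth P 1"
    by (simp add: S_def power2_eq_square numeral_2_eq_2)
  have S1: "fps_nth S 1 = 24 * fps_nth F 4 - 48 * fps_nth F 2 * fps_nth F 3 + 24 * (fps_nth F 2) ^ 3"
    unfolding S1' P0 P1 P2 by (simp add: power2_eq_square power3_eq_cube algebra_simps)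
  show "\<sigma> 3 f 0 = 6 * (fps_nth F 3 - (fps_nth F 2)\<^sup>2)"
    using has_fps_expansion_imp_0_eq_fps_nth_0[OF S] by (simp add: \<sigma>3 S0)
  have "\<sigma> 4 f 0 = fps_nth S 1 - 2 * fps_nth S 0 * fps_nth P 0"
    using has_fps_expansion_imp_0_eq_fps_nth_0[OF T] by (simp add: T_def)
  then show "\<sigma> 4 f 0 = 24 * (fps_nth F 4 - 3 * fps_nth F 2 * fps_nth F 3 + 2 * (fps_nth F 2) ^ 3)"
    unfolding S0 S1 P0 by (simp add: eval_nat_numeral algebra_simps)
qed

text \<open>With h_k the coefficients of arsinh (\<omega> z), the equation z f' = f (1 + arsinh
  \<omega>) becomes the recursion (n - 1) a_n = a_1 h_(n-1) + ... + a_(n-1) h_1. Both the bounds and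
  the extremal values are computed from the result.\<close>

lemma higher_Schwarzian_Schwarz_function:
  assumes f: "f \<in> class_A" and hol: "\<omega> holomorphic_on ball 0 1" and "\<omega> 0 = 0"
    and eq: "\<And>z. cmod z < 1 \<Longrightarrow> cmod (\<omega> z) < 1 \<and> starlike_quotient f z = 1 + arsinh (\<omega> z)"
    and W: "\<omega> has_fps_expansion W"
  shows "\<sigma> 3 f 0 = 3 * (fps_nth W 2 - (fps_nth W 1)\<^sup>2)"
    and "\<sigma> 4 f 0 = 8 * (fps_nth W 3 - 3 * fps_nth W 1 * fps_nth W 2 + 11 / 6 * fps_nth W 1 ^ 3)"
proof -
  have f0: "f 0 = 0" "deriv f 0 = 1" "f holomorphic_on ball 0 1"
    using f by (auto simp: class_A_def)
  define F where "F = fps_expansion f 0"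
  have F: "f has_fps_expansion F"
    unfolding F_def by (rule has_fps_expansion_fps_expansion[OF _ _ f0(3)]) auto
  have F0: "fps_nth F 0 = 0"
    using has_fps_expansion_imp_0_eq_fps_nth_0[OF F] f0 by simp
  have F1: "fps_nth F 1 = 1"
    using has_fps_expansion_imp_0_eq_fps_nth_0[OF has_fps_expansion_deriv[OF F]] f0 by simp
  have W0: "fps_nth W 0 = 0"
    using has_fps_expansion_imp_0_eq_fps_nth_0[OF W] \<open>\<omega> 0 = 0\<close> by simp
  obtain A :: "complex fps" where A: "arsinh has_fps_expansion A"
    and An: "fps_nth A 0 = 0" "fps_nth A 1 = 1" "fps_nth A 2 = 0" "fps_nth A 3 = - 1 / 6"
    using arsinh_fps_expansion by blast
  have H: "(\<lambda>z. arsinh (\<omega> z)) has_fps_expansion (A oo W)"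
    using has_fps_expansion_compose[OF A W W0] by (simp add: o_def)
  have Q: "z * deriv f z = f z * (1 + arsinh (\<omega> z))" if z: "cmod z < 1" for z
  proof (cases "f z = 0")
    case True
    \<comment> \<open>Away from the origin HOL's \<open>x / 0 = 0\<close> would force \<open>arsinh (\<omega> z) = -1\<close>,
      which is impossible because \<open>sinh 1 > 1\<close>.\<close>
    have "arsinh (\<omega> z) \<noteq> -1"
    proof
      assume "arsinh (\<omega> z) = -1"
      then have "\<omega> z = sinh (-1)"
        using sinh_arsinh[of "\<omega> z"] eq[OF z] by simp
      also have "\<dots> = of_real (- sinh 1)"
        by (simp add: sinh_def scaleR_conv_of_real field_simps flip: exp_of_real)
      finally have "\<bar>sinh 1 :: real\<bar> < 1"
        using eq[OF z] by simp
      \<comment> \<open>The quadratic Taylor bound 1 + 1 + 1/2 is enough, since it gives sinh 1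
        \<ge> (5/2 - 2/5) / 2 = 21/20.\<close>
      moreover have "exp 1 \<ge> (5 / 2 :: real)"
        using exp_lower_Taylor_quadratic[of 1] by simp
      then have "exp (- 1) \<le> (2 / 5 :: real)"
        by (simp add: exp_minus field_simps)
      with \<open>exp 1 \<ge> 5 / 2\<close> have "sinh 1 \<ge> (1 :: real)"
        by (simp add: sinh_def)
      ultimately show False by linarith
    qed
    then have "z = 0"
      using True eq[OF z] by (auto simp: starlike_quotient_def add_eq_0_iff split: if_splits)
    then show ?thesis by (simp add: f0)
  next
    case False
    then show ?thesis
      using eq[OF z] f0 by (auto simp: starlike_quotient_def field_simps split: if_splits)
  qed
  have "fps_X * fps_deriv F = F * (1 + (A oo W))"
  proof (rule has_fps_expansion_unit_disc_eqD)
    show "(\<lambda>z. z * deriv f z) has_fps_expansion fps_X * fps_deriv F"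
      by (intro fps_expansion_intros F)
    show "(\<lambda>z. f z * (1 + arsinh (\<omega> z))) has_fps_expansion F * (1 + (A oo W))"
      by (intro fps_expansion_intros F H)
  qed (rule Q)
  then have FX: "fps_nth (fps_X * fps_deriv F) n = fps_nth (F * (1 + (A oo W))) n" for n
    by simp
  \<comment> \<open>As \<open>arsinh\<close> has no quadratic term, composing with it alters, up to
    order 3, only the cubic coefficient of \<open>W\<close>.\<close>
  have H0: "fps_nth (A oo W) 0 = 0" and H1: "fps_nth (A oo W) 1 = fps_nth W 1"
    and H2: "fps_nth (A oo W) 2 = fps_nth W 2"
    and H3: "fps_nth (A oo W) 3 = fps_nth W 3 - fps_nth W 1 ^ 3 / 6"
    using An W0 by (simp_all add: fps_compose_nth fps_mult_nth eval_nat_numeral)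
  have F2: "fps_nth F 2 = fps_nth W 1"
    using FX[of 2, unfolded fps_nth_mult_2] F0 F1 H0 H1
    by (simp add: eval_nat_numeral)
  have F3: "fps_nth F 3 = (fps_nth W 2 + (fps_nth W 1)\<^sup>2) / 2"
    using FX[of 3, unfolded fps_nth_mult_3] F0 F1 F2 H0 H1 H2
    by (simp add: eval_nat_numeral field_simps)
  have "3 * fps_nth F 4 = fps_nth (A oo W) 3 + fps_nth W 1 * fps_nth W 2 + fps_nth W 1 * fps_nth F 3"
    using FX[of 4] F0 F1 F2 H0 H1 H2
    by (simp add: fps_mult_nth eval_nat_numeral)
  then have F4: "fps_nth F 4 = (fps_nth W 3 - fps_nth W 1 ^ 3 / 6) / 3
      + fps_nth W 1 * fps_nth W 2 / 2 + fps_nth W 1 ^ 3 / 6"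
    unfolding H3 F3 by (simp add: field_simps power2_eq_square power3_eq_cube) algebra
  show "\<sigma> 3 f 0 = 3 * (fps_nth W 2 - (fps_nth W 1)\<^sup>2)"
    unfolding higher_Schwarzian_fps(1)[OF F F1] F2 F3 by (simp add: field_simps)
  show "\<sigma> 4 f 0 = 8 * (fps_nth W 3 - 3 * fps_nth W 1 * fps_nth W 2 + 11 / 6 * fps_nth W 1 ^ 3)"
    unfolding higher_Schwarzian_fps(2)[OF F F1] F2 F3 F4
    by (simp add: field_simps power2_eq_square power3_eq_cube)
qed

section \<open>The extremal function\<close>

text \<open>Integrating f'/f = 1/z + (arsinh z)/z yields f(z) = z exp (Q(z) - Q(0)), where Q is a
  primitive of the holomorphic function (arsinh z)/z.\<close>

lemma starlike_quotient_extremal: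
  obtains f where "f \<in> class_A" "\<And>z. cmod z < 1 \<Longrightarrow> starlike_quotient f z = 1 + arsinh z"
proof -
  obtain q where q: "q holomorphic_on ball 0 1"
    "\<And>z. cmod z < 1 \<Longrightarrow> arsinh z = z * q z"
    using Schwarz3[OF arsinh_holomorphic arsinh_0_complex] by blast
  obtain Q where Q: "\<And>z. z \<in> ball 0 1 \<Longrightarrow> (Q has_field_derivative q z) (at z within ball 0 1)"
    using holomorphic_convex_primitive'[OF convex_ball open_ball q(1)] by blast
  then have Q': "(Q has_field_derivative q z) (at z)" if "cmod z < 1" for z
    using that by (metis at_within_open mem_ball_0 open_ball)
  \<comment> \<open>Subtracting \<open>Q 0\<close> normalises f'(0) to 1.\<close>
  define f where "f = (\<lambda>z. z * exp (Q z - Q 0))"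
  have f': "(f has_field_derivative exp (Q z - Q 0) * (1 + arsinh z)) (at z)" if z: "cmod z < 1" for z
    unfolding f_def q(2)[OF z]
    by (auto intro!: derivative_eq_intros Q' z simp: algebra_simps)
  show thesis
  proof (rule that)
    have "\<exists>D. (f has_field_derivative D) (at z)" if "z \<in> ball 0 1" for z
      using f'[of z] that by auto
    then have "f holomorphic_on ball 0 1"
      by (simp add: holomorphic_on_open)
    then show "f \<in> class_A"
      using DERIV_imp_deriv[OF f'[of 0]] by (simp add: class_A_def arsinh_0_complex f_def)
    show "starlike_quotient f z = 1 + arsinh z" if "cmod z < 1" for z
      using DERIV_imp_deriv[OF f'[OF that]]
      by (simp add: starlike_quotient_def arsinh_0_complex f_def)
  qed
qed

section \<open>The two bounds and their sharpness\<close>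

theorem theorem3p2:
  shows "(\<forall>f\<in>S_rho. cmod (\<sigma> 3 f 0) \<le> 3 \<and> cmod (\<sigma> 4 f 0) \<le> 44 / 3) \<and>
         (\<exists>f\<in>S_rho. cmod (\<sigma> 3 f 0) = 3) \<and>
         (\<exists>f\<in>S_rho. cmod (\<sigma> 4 f 0) = 44 / 3)"
proof (intro conjI ballI)
  fix f assume "f \<in> S_rho"
  then obtain \<omega> where f: "f \<in> class_A" and \<omega>: "\<omega> holomorphic_on ball 0 1" "\<omega> 0 = 0"
    and sub: "\<And>z. cmod z < 1 \<Longrightarrow> cmod (\<omega> z) < 1 \<and> starlike_quotient f z = 1 + arsinh (\<omega> z)"
    by (auto simp: S_rho_def subordinate_def)
  define W where "W = fps_expansion \<omega> 0"
  have W: "\<omega> has_fps_expansion W"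
    unfolding W_def by (rule has_fps_expansion_fps_expansion[OF _ _ \<omega>(1)]) auto
  define b where "b = fps_nth W 1"
  define s where "s = 1 - (cmod b)\<^sup>2"
  have \<sigma>: "\<sigma> 3 f 0 = 3 * (fps_nth W 2 - b\<^sup>2)"
    "\<sigma> 4 f 0 = 8 * (fps_nth W 3 - 3 * b * fps_nth W 2 + 11 / 6 * b ^ 3)"
    unfolding b_def
    by (rule higher_Schwarzian_Schwarz_function[OF f \<omega> _ W], use sub in blast)+
  obtain \<zeta> \<eta> :: complex where bd: "cmod b \<le> 1" "cmod \<zeta> \<le> 1" "cmod \<eta> \<le> 1"
    and W23: "fps_nth W 2 = \<zeta> * (1 - (cmod b)\<^sup>2)"
      "fps_nth W 3 = (1 - (cmod b)\<^sup>2) * (\<eta> * (1 - (cmod \<zeta>)\<^sup>2) - \<zeta>\<^sup>2 * cnj b)"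
    unfolding b_def by (rule Schwarz_function_coefficients[OF \<omega> _ W]) (use sub in blast)+
  have W2: "fps_nth W 2 = \<zeta> * s"
    and W3: "fps_nth W 3 = s * (\<eta> * (1 - (cmod \<zeta>)\<^sup>2) - \<zeta>\<^sup>2 * cnj b)"
    using W23 by (simp_all add: s_def)
  have s: "0 \<le> s" using bd(1) by (simp add: s_def power_le_one)
  \<comment> \<open>For sigma_3 the plain triangle inequality suffices, because \<open>s\<close> +
    |\<open>b\<close>|^2 = 1.\<close>
  have "cmod (\<zeta> * s - b\<^sup>2) \<le> cmod \<zeta> * s + (cmod b)\<^sup>2"
    using norm_triangle_ineq4[of "\<zeta> * s" "b\<^sup>2"] s by (simp add: norm_mult norm_power)
  also have "\<dots> \<le> 1 * s + (cmod b)\<^sup>2"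
    using bd(2) s by (intro add_mono mult_right_mono) auto
  finally show "cmod (\<sigma> 3 f 0) \<le> 3"
    unfolding \<sigma>(1) W2 norm_mult by (simp add: s_def)
  \<comment> \<open>This is the coefficient of \<open>\<eta>\<close>; it cancels against the loss in
    \<open>Schur_parameter_bound\<close>, leaving 11/6, and 8 * 11/6 = 44/3.\<close>
  define y where "y = s * (1 - (cmod \<zeta>)\<^sup>2)"
  have y: "0 \<le> y" using bd(2) s by (simp add: y_def power_le_one)
  have "fps_nth W 3 - 3 * b * fps_nth W 2 + 11 / 6 * b ^ 3
      = y * \<eta> + (11 / 6 * b ^ 3 - s * (\<zeta>\<^sup>2 * cnj b + 3 * b * \<zeta>))"
    unfolding W2 W3 y_def by (simp add: algebra_simps)
  also have "cmod \<dots> \<le> y + (11 / 6 - y)"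
  proof (rule norm_triangle_mono)
    show "cmod (y * \<eta>) \<le> y"
      using y bd(3) by (simp add: norm_mult mult_left_le)
    show "cmod (11 / 6 * b ^ 3 - s * (\<zeta>\<^sup>2 * cnj b + 3 * b * \<zeta>)) \<le> 11 / 6 - y"
      unfolding y_def s_def by (rule Schur_parameter_bound[OF bd(1,2)])
  qed
  finally have "cmod (fps_nth W 3 - 3 * b * fps_nth W 2 + 11 / 6 * b ^ 3) \<le> 11 / 6"
    by simp
  then show "cmod (\<sigma> 4 f 0) \<le> 44 / 3"
    unfolding \<sigma>(2) norm_mult by simp
next
  obtain f where f: "f \<in> class_A"
    and eq: "\<And>z. cmod z < 1 \<Longrightarrow> starlike_quotient f z = 1 + arsinh z"
    using starlike_quotient_extremal by blast
  have hol: "(\<lambda>z. 1 + arsinh z :: complex) holomorphic_on ball 0 1"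
    by (intro holomorphic_intros arsinh_holomorphic)
  \<comment> \<open>Membership in \<open>S_rho\<close> also asks for holomorphy of the quotient at
    0, where it is defined by cases; agreement with 1 + arsinh z on the disc supplies it.\<close>
  then have "starlike_quotient f holomorphic_on ball 0 1"
    by (rule holomorphic_transform) (simp add: eq)
  with hol have "f \<in> S_rho"
    unfolding S_rho_def subordinate_def using f eq
    by (auto intro!: exI[of _ "\<lambda>z. z"] holomorphic_intros)
  \<comment> \<open>The Schwarz function z has the expansion \<open>fps_X\<close>, so b1 = 1 and b2
    = b3 = 0; the values are -3 and 44/3.\<close>
  have \<sigma>: "\<sigma> 3 f 0 = 3 * (fps_nth fps_X 2 - (fps_nth fps_X 1)\<^sup>2)"
    "\<sigma> 4 f 0 = 8 * (fps_nth fps_X 3 - 3 * fps_nth fps_X 1 * fps_nth fps_X 2 + 11 / 6 * fps_nth fps_X 1 ^ 3)"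
    by (rule higher_Schwarzian_Schwarz_function[OF f, of "\<lambda>z. z"];
        use eq in \<open>auto intro: holomorphic_intros fps_expansion_intros\<close>)+
  show "\<exists>f\<in>S_rho. cmod (\<sigma> 3 f 0) = 3"
    by (rule bexI[OF _ \<open>f \<in> S_rho\<close>]) (simp add: \<sigma>(1))
  show "\<exists>f\<in>S_rho. cmod (\<sigma> 4 f 0) = 44 / 3"
    by (rule bexI[OF _ \<open>f \<in> S_rho\<close>]) (simp add: \<sigma>(2))
qed

end
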